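(* Let $\gamma\in\mathbb{R}$, $\tau>0$, $z\in\mathbb{R}^n_+$, and let $I$ be a finite set. For every $i\in I$ define $A^{(i)}=\mathrm{id}+\exp(L^{(i)}\tau)$ and $p^{(i)}=2(A^{(i)}z+v^{(i)})$, where $L^{(i)}\in\mathbb{R}^{n\times n}$ is essentially nonnegative and $v^{(i)}\in\mathbb{R}^n_+$. For $s\in\mathbb{R}$ let $V_s=\{v\in\mathbb{R}^n\mid v_1+\dots+v_n=s\}$, let $\widetilde E\colon(\mathbb{R}_+\setminus\{0\})^n\to\mathbb{R}_+$ be given by $$\widetilde E(\xi)=\sum_{i\in I}E_{A^{(i)},p^{(i)}}(\xi),\qquad\text{where } E_{A,p}(\xi)=\prod_{k=1}^n\frac1{\xi_k}\Bigl(p_k+\sum_{j=1}^nA_{k,j}\xi_j\Bigr),$$ and let $\widetilde g(x)=\widetilde E(\exp(x))$ for $x\in\mathbb{R}^n$. For some $i\in I$ suppose that $L^{(i)}$ or $$\begin{pmatrix}L^{(i)}&z+L^{(i)}z+v^{(i)}\\ \mathbf{1}&1\end{pmatrix}$$ is irreducible. Then the optimization problem $$\min_{\xi>0}\widetilde E(\xi)\quad\text{subject to}\quad\exp(\gamma)=\prod_{k=1}^n\xi_k$$ possesses a unique solution. Moreover, $\widetilde g\,''(x)h^2>0$ for all $x\in V_\gamma$ and $h\in V_0\setminus\{0\}$, and $\widetilde g(x)\to\infty$ as $\|x\|_\infty\to\infty$, $x\in V_\gamma$.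
   Context: $\mathbb{R}_+$ is the set of nonnegative reals, $\mathrm{id}$ is the identity matrix, and $\xi>0$ is meant component-wise. $\exp$ of a vector is taken component-wise, while $\exp$ of a square matrix is the matrix exponential. $\mathbf{1}$ denotes the all-ones vector (here a row of length $n$, so that the displayed block matrix is $(n+1)\times(n+1)$). $\widetilde g\,''(x)h^2$ denotes the second derivative of $\widetilde g$ at $x$ evaluated at $(h,h)$. A matrix $L\in\mathbb{R}^{n\times n}$ is essentially nonnegative if $L_{i,j}\ge0$ whenever $i\neq j$. A matrix $M\in\mathbb{R}^{k\times k}$ is irreducible if for any $r,s\in\{1,\dots,k\}$ with $r\ne s$ there exist distinct indices $i_1,\dots,i_m\in\{1,\dots,k\}$ with $i_1=r$, $i_m=s$ and $M_{i_l,i_{l+1}}>0$ for all $l\in\{1,\dots,m-1\}$. *)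

theory Defs
  imports "HOL-Analysis.Analysis"
begin

(* The library's ( * ), (^) and exp are not the matrix operations on real^'n^'n:
   multiplication there is entrywise and exp is not available.  Hence matrix powers
   are iterates of ( ** ), and the series below is taken in the usual topology. *)
definition matrix_power :: "real^'n^'n \<Rightarrow> nat \<Rightarrow> real^'n^'n" where
  "matrix_power M m = (((**) M) ^^ m) (mat 1)"

definition matrix_exp :: "real^'n^'n \<Rightarrow> real^'n^'n" where
  "matrix_exp M = (\<Sum>m. (1 / fact m) *\<^sub>R matrix_power M m)"

definition vec_exp :: "real^'n \<Rightarrow> real^'n" where
  "vec_exp x = (\<chi> k. exp (x $ k))"

definition essentially_nonneg :: "real^'n^'n \<Rightarrow> bool" where
  "essentially_nonneg L \<longleftrightarrow> (\<forall>i j. i \<noteq> j \<longrightarrow> 0 \<le> L $ i $ j)"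

(* Only strictly positive entries count as edges, and the path is a list of distinct indices.
   Every 1 x 1 matrix is irreducible in this sense. *)
definition irreducible_matrix :: "real^'k^'k \<Rightarrow> bool" where
  "irreducible_matrix M \<longleftrightarrow>
     (\<forall>r s. r \<noteq> s \<longrightarrow>
        (\<exists>path. path \<noteq> [] \<and> distinct path \<and> hd path = r \<and> last path = s \<and>
           (\<forall>l. Suc l < length path \<longrightarrow> 0 < M $ (path ! l) $ (path ! Suc l))))"

(* The block matrix with rows (L, c) and (r, d); the additional last index is None. *)
definition bordered_matrix ::
    "real^'n^'n \<Rightarrow> real^'n \<Rightarrow> real^'n \<Rightarrow> real \<Rightarrow> real^('n option)^('n option)" where
  "bordered_matrix L c r d =
     (\<chi> a b. case a of
        Some i \<Rightarrow> (case b of Some j \<Rightarrow> L $ i $ j | None \<Rightarrow> c $ i)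
      | None \<Rightarrow> (case b of Some j \<Rightarrow> r $ j | None \<Rightarrow> d))"

definition sum_hyperplane :: "real \<Rightarrow> (real^'n) set" where
  "sum_hyperplane s = {v. (\<Sum>k\<in>UNIV. v $ k) = s}"

(* Meaningful for componentwise positive \<xi> only. *)
definition E_fun :: "real^'n^'n \<Rightarrow> real^'n \<Rightarrow> real^'n \<Rightarrow> real" where
  "E_fun A p \<xi> = (\<Prod>k\<in>UNIV. 1 / \<xi> $ k * (p $ k + (\<Sum>j\<in>UNIV. A $ k $ j * \<xi> $ j)))"

definition E_tilde ::
    "'i set \<Rightarrow> ('i \<Rightarrow> real^'n^'n) \<Rightarrow> ('i \<Rightarrow> real^'n) \<Rightarrow> real^'n \<Rightarrow> real" where
  "E_tilde I A p \<xi> = (\<Sum>i\<in>I. E_fun (A i) (p i) \<xi>)"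

definition g_tilde ::
    "'i set \<Rightarrow> ('i \<Rightarrow> real^'n^'n) \<Rightarrow> ('i \<Rightarrow> real^'n) \<Rightarrow> real^'n \<Rightarrow> real" where
  "g_tilde I A p x = E_tilde I A p (vec_exp x)"

(* f is twice Frechet differentiable at x with second derivative D, where f''(x)(h,k) is D h k. *)
definition has_second_derivative_at ::
    "('a::real_normed_vector \<Rightarrow> 'b::real_normed_vector) \<Rightarrow> ('a \<Rightarrow>\<^sub>L 'a \<Rightarrow>\<^sub>L 'b) \<Rightarrow> 'a \<Rightarrow> bool" where
  "has_second_derivative_at f D x \<longleftrightarrow>
     (\<exists>f'. (\<forall>\<^sub>F y in nhds x. (f has_derivative blinfun_apply (f' y)) (at y)) \<and>
           (f' has_derivative blinfun_apply D) (at x))"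

end

(* Expanding the products turns g_tilde into a finite sum of exponentials c * exp (alpha . x) with
   c >= 0, so everything reduces to the exponents alpha with c > 0.  Every diagonal entry of A i is
   positive, hence choosing the diagonal term in all factors but the k-th shows that e_j - e_k occurs
   whenever A i has a positive (k, j) entry, and - e_k whenever p i $ k > 0.  Irreducibility chains
   these exponents together: if alpha . x <= C for all of them, then x is bounded linearly in C and
   in its coordinate sum.  The positivity of exp (tau L) at the edges of L follows by writing
   tau L = P + t id with P >= 0, since then exp (tau L) = exp t * exp P. *)

theory Submission
  imports Defs
begin

section \<open>Matrix powers and the exponential of an essentially nonnegative matrix\<close>

lemma matrix_power_0 [simp]: "matrix_power M 0 = mat 1"
  by (simp add: matrix_power_def)

lemma matrix_power_Suc: "matrix_power M (Suc m) = M ** matrix_power M m"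
  by (simp add: matrix_power_def)

lemma sums_vecI:
  fixes f :: "nat \<Rightarrow> ('a::real_normed_vector)^'n"
  assumes "\<And>i. (\<lambda>m. f m $ i) sums (s $ i)"
  shows "f sums s"
  using assms unfolding sums_def by (intro vec_tendstoI) (simp add: sum_component)

lemma matrix_power_nonneg:
  assumes "\<And>i j. 0 \<le> P $ i $ j"
  shows "0 \<le> matrix_power P m $ i $ j"
proof (induction m arbitrary: i j)
  case 0
  then show ?case by (simp add: mat_def)
next
  case (Suc m)
  then show ?case
    by (simp add: matrix_power_Suc matrix_matrix_mult_def assms sum_nonneg)
qed

text \<open>Each multiplication by \<open>P\<close> sums n products, which costs a factor n * b.
  This crude geometric growth is enough to dominate the entry series by a scalar exponential
  series.\<close>

lemma matrix_power_entry_bound: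
  fixes P :: "real^'n^'n"
  assumes "\<And>i j. \<bar>P $ i $ j\<bar> \<le> b"
  shows "\<bar>matrix_power P m $ i $ j\<bar> \<le> (real CARD('n) * b) ^ m"
proof (induction m arbitrary: i j)
  case 0
  then show ?case by (simp add: mat_def)
next
  case (Suc m)
  have b: "0 \<le> b" using assms[of i j] by linarith
  have "\<bar>matrix_power P (Suc m) $ i $ j\<bar> \<le> (\<Sum>k\<in>UNIV. \<bar>P $ i $ k * matrix_power P m $ k $ j\<bar>)"
    by (simp add: matrix_power_Suc matrix_matrix_mult_def)
  also have "\<dots> \<le> (\<Sum>k\<in>(UNIV::'n set). b * (real CARD('n) * b) ^ m)"
    unfolding abs_mult by (intro sum_mono mult_mono assms Suc b) simp
  also have "\<dots> = (real CARD('n) * b) ^ Suc m" by simp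
  finally show ?case .
qed

lemma summable_matrix_exp_entry:
  fixes P :: "real^'n^'n"
  shows "summable (\<lambda>m. \<bar>matrix_power P m $ i $ j / fact m\<bar>)"
proof -
  define b where "b = (\<Sum>i\<in>UNIV. \<Sum>j\<in>UNIV. \<bar>P $ i $ j\<bar>)"
  have "\<bar>P $ k $ l\<bar> \<le> b" for k l
  proof -
    have "\<bar>P $ k $ l\<bar> \<le> (\<Sum>j\<in>UNIV. \<bar>P $ k $ j\<bar>)"
      by (rule member_le_sum) auto
    also have "\<dots> \<le> b" unfolding b_def
      by (rule member_le_sum[where f = "\<lambda>i. \<Sum>j\<in>UNIV. \<bar>P $ i $ j\<bar>"]) (auto intro: sum_nonneg)
    finally show ?thesis .
  qed
  then have "\<bar>matrix_power P m $ i $ j\<bar> \<le> (real CARD('n) * b) ^ m" for m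
    by (rule matrix_power_entry_bound)
  then have "norm \<bar>matrix_power P m $ i $ j / fact m\<bar> \<le> inverse (fact m) * (real CARD('n) * b) ^ m" for m
    by (simp add: divide_simps)
  then show ?thesis
    by (intro summable_comparison_test[OF _ summable_exp]) auto
qed

text \<open>This is the binomial theorem, valid because the scalar matrix \<open>mat t\<close>
  commutes with \<open>P\<close>; the induction is Pascal's rule.\<close>

lemma matrix_power_add_mat:
  fixes P :: "real^'n^'n"
  shows "matrix_power (P + mat t) m $ i $ j =
    (\<Sum>k\<le>m. real (m choose k) * t ^ (m - k) * matrix_power P k $ i $ j)"
proof (induction m arbitrary: i j)
  case 0
  then show ?case by simp
next
  case (Suc m)
  let ?a = "\<lambda>k. matrix_power P k $ i $ j"
  have mat_mult: "(mat t ** X) $ i $ j = t * X $ i $ j" for X :: "real^'n^'n"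
    by (simp add: matrix_matrix_mult_def mat_def if_distrib[of "\<lambda>x. x * _"] cong: if_cong)
  have "(\<Sum>l\<in>UNIV. P $ i $ l * matrix_power (P + mat t) m $ l $ j)
      = (\<Sum>k\<le>m. \<Sum>l\<in>UNIV. P $ i $ l * (real (m choose k) * t ^ (m - k) * matrix_power P k $ l $ j))"
    unfolding Suc sum_distrib_left by (rule sum.swap)
  also have "\<dots> = (\<Sum>k\<le>m. real (m choose k) * t ^ (m - k) * ?a (Suc k))"
    by (simp add: matrix_power_Suc matrix_matrix_mult_def sum_distrib_left mult_ac)
  finally have "matrix_power (P + mat t) (Suc m) $ i $ j
     = (\<Sum>k\<le>m. real (m choose k) * t ^ (m - k) * ?a (Suc k))
       + t * (\<Sum>k\<le>m. real (m choose k) * t ^ (m - k) * ?a k)"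
    using mat_mult[of "matrix_power (P + mat t) m"]
    by (simp add: matrix_power_Suc matrix_matrix_mult_def distrib_right sum.distrib Suc)
  \<comment> \<open>The added index \<open>Suc m\<close> contributes nothing, since
    \<open>m choose Suc m\<close> is 0. Both sums can then be aligned by splitting off the index
    0.\<close>
  also have "t * (\<Sum>k\<le>m. real (m choose k) * t ^ (m - k) * ?a k)
     = (\<Sum>k\<le>Suc m. real (m choose k) * t ^ (Suc m - k) * ?a k)"
    by (simp add: sum_distrib_left Suc_diff_le mult_ac)
  also have "\<dots> = t ^ Suc m * ?a 0 + (\<Sum>k\<le>m. real (m choose Suc k) * t ^ (m - k) * ?a (Suc k))"
    by (subst sum.atMost_Suc_shift) simp
  also have "(\<Sum>k\<le>m. real (m choose k) * t ^ (m - k) * ?a (Suc k)) + \<dots>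
     = t ^ Suc m * ?a 0 + (\<Sum>k\<le>m. real (Suc m choose Suc k) * t ^ (m - k) * ?a (Suc k))"
    by (simp add: sum.distrib algebra_simps)
  also have "\<dots> = (\<Sum>k\<le>Suc m. real (Suc m choose k) * t ^ (Suc m - k) * ?a k)"
    by (subst sum.atMost_Suc_shift) simp
  finally show ?case .
qed

text \<open>For each entry, the binomial formula divided by \<open>fact m\<close> is the Cauchy
  product of the series for \<open>P\<close> with the scalar series for \<open>exp t\<close>.
  Entrywise convergence then identifies the matrix series.\<close>

lemma matrix_exp_add_mat_entry:
  fixes P :: "real^'n^'n"
  shows "matrix_exp (P + mat t) $ i $ j = (\<Sum>m. matrix_power P m $ i $ j / fact m) * exp t"
proof -
  define e where "e = (\<lambda>i j. (\<Sum>m. matrix_power P m $ i $ j / fact m) * exp t)"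
  have *: "(\<lambda>m. matrix_power (P + mat t) m $ i $ j / fact m) sums e i j" for i j
  proof -
    have "summable (\<lambda>m. norm (inverse (fact m) * t ^ m))"
      using summable_exp[of "\<bar>t\<bar>"] by (simp add: abs_mult power_abs)
    then have "(\<lambda>m. \<Sum>k\<le>m. matrix_power P k $ i $ j / fact k * (inverse (fact (m - k)) * t ^ (m - k)))
        sums ((\<Sum>m. matrix_power P m $ i $ j / fact m) * (\<Sum>m. inverse (fact m) * t ^ m))"
      using summable_matrix_exp_entry[of P i j]
      by (intro Cauchy_product_sums) simp_all
    moreover have "(\<Sum>k\<le>m. matrix_power P k $ i $ j / fact k * (inverse (fact (m - k)) * t ^ (m - k)))
        = matrix_power (P + mat t) m $ i $ j / fact m" for m
      unfolding matrix_power_add_mat sum_divide_distrib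
      by (intro sum.cong) (simp_all add: binomial_fact field_simps)
    ultimately show ?thesis
      by (simp add: e_def exp_def)
  qed
  have "(\<lambda>m. (1 / fact m) *\<^sub>R matrix_power (P + mat t) m) sums (\<chi> i j. e i j)"
    using * by (intro sums_vecI) simp
  then have "matrix_exp (P + mat t) = (\<chi> i j. e i j)"
    unfolding matrix_exp_def by (rule sums_unique[symmetric])
  then show ?thesis by (simp add: e_def)
qed

lemma essentially_nonneg_shift:
  fixes L :: "real^'n^'n"
  assumes "essentially_nonneg L"
  obtains P t where "L = P + mat t" "\<And>i j. 0 \<le> P $ i $ j"
proof
  \<comment> \<open>Subtracting this scalar raises every diagonal entry by at least its own absolute
    value and leaves the other entries alone.\<close>
  define t where "t = - (\<Sum>k\<in>UNIV. \<bar>L $ k $ k\<bar>)"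
  show "L = (L - mat t) + mat t" by simp
  show "0 \<le> (L - mat t) $ i $ j" for i j
  proof (cases "i = j")
    case True
    have "\<bar>L $ i $ i\<bar> \<le> - t"
      unfolding t_def minus_minus by (rule member_le_sum[where f = "\<lambda>k. \<bar>L $ k $ k\<bar>"]) auto
    with True show ?thesis by (simp add: mat_def)
  next
    case False
    with assms show ?thesis by (simp add: mat_def essentially_nonneg_def)
  qed
qed

text \<open>After the shift all terms of the entry series are nonnegative, and the term of order 1
  is the entry of \<open>P\<close>, which off the diagonal is that of \<open>L\<close>.\<close>

lemma essentially_nonneg_matrix_exp:
  fixes L :: "real^'n^'n"
  assumes "essentially_nonneg L"
  shows matrix_exp_nonneg: "0 \<le> matrix_exp L $ i $ j"
    and matrix_exp_pos: "i \<noteq> j \<Longrightarrow> 0 < L $ i $ j \<Longrightarrow> 0 < matrix_exp L $ i $ j"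
proof -
  obtain P t where L: "L = P + mat t" and P: "\<And>i j. 0 \<le> P $ i $ j"
    using essentially_nonneg_shift[OF assms] by blast
  have s: "summable (\<lambda>m. matrix_power P m $ i $ j / fact m)"
    using summable_matrix_exp_entry by (rule summable_rabs_cancel)
  have nn: "0 \<le> matrix_power P m $ i $ j / fact m" for m
    by (simp add: matrix_power_nonneg P)
  show "0 \<le> matrix_exp L $ i $ j"
    unfolding L matrix_exp_add_mat_entry by (simp add: suminf_nonneg s nn)
  assume "i \<noteq> j" "0 < L $ i $ j"
  then have "0 < P $ i $ j" by (simp add: L mat_def)
  then have "0 < matrix_power P 1 $ i $ j / fact 1" by (simp add: matrix_power_Suc)
  then have "0 < (\<Sum>m. matrix_power P m $ i $ j / fact m)"
    using s nn by (rule suminf_pos2[rotated 2])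
  then show "0 < matrix_exp L $ i $ j"
    unfolding L matrix_exp_add_mat_entry by simp
qed

section \<open>Sums of exponentials: second derivative, convexity, sublevel sets\<close>

text \<open>For nonnegative \<open>c\<close> this is a posynomial (with real exponents) in
  logarithmic coordinates.\<close>

definition exp_sum :: "'s set \<Rightarrow> ('s \<Rightarrow> real) \<Rightarrow> ('s \<Rightarrow> 'a::euclidean_space) \<Rightarrow> 'a \<Rightarrow> real" where
  "exp_sum S c \<alpha> x = (\<Sum>s\<in>S. c s * exp (\<alpha> s \<bullet> x))"

lemma exp_sum_second_derivative:
  fixes \<alpha> :: "'s \<Rightarrow> 'a::euclidean_space"
  shows "\<exists>D. has_second_derivative_at (exp_sum S c \<alpha>) D x \<and>
    (\<forall>h. blinfun_apply (blinfun_apply D h) h = (\<Sum>s\<in>S. c s * exp (\<alpha> s \<bullet> x) * (\<alpha> s \<bullet> h)\<^sup>2))"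
proof -
  define f' where "f' y = (\<Sum>s\<in>S. (c s * exp (\<alpha> s \<bullet> y)) *\<^sub>R blinfun_inner_right (\<alpha> s))" for y
  \<comment> \<open>The composition sends h to (\<alpha> s . h) times the functional \<alpha> s, so
    D is a weighted sum of rank-one quadratic forms.\<close>
  define D where "D = (\<Sum>s\<in>S. (c s * exp (\<alpha> s \<bullet> x)) *\<^sub>R
    (blinfun_scaleR_left (blinfun_inner_right (\<alpha> s)) o\<^sub>L blinfun_inner_right (\<alpha> s)))"
  have "(exp_sum S c \<alpha> has_derivative blinfun_apply (f' y)) (at y)" for y
    unfolding exp_sum_def[abs_def] f'_def
    by (auto intro!: derivative_eq_intros ext simp: blinfun.sum_left blinfun.scaleR_left algebra_simps)
  moreover have "(f' has_derivative blinfun_apply D) (at x)"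
    unfolding f'_def[abs_def] D_def
    by (auto intro!: derivative_eq_intros ext
        simp: blinfun.sum_left blinfun.scaleR_left algebra_simps)
  ultimately have "has_second_derivative_at (exp_sum S c \<alpha>) D x"
    unfolding has_second_derivative_at_def by (intro exI[of _ f']) simp
  moreover have "blinfun_apply (blinfun_apply D h) h = (\<Sum>s\<in>S. c s * exp (\<alpha> s \<bullet> x) * (\<alpha> s \<bullet> h)\<^sup>2)" for h
    by (simp add: D_def blinfun.sum_left blinfun.scaleR_left power2_eq_square mult_ac)
  ultimately show ?thesis by blast
qed

text \<open>This is the strict arithmetic-geometric mean inequality, from the square of
  \<open>exp (a / 2) - exp (b / 2)\<close>.\<close>

lemma exp_midpoint_less:
  fixes a b :: real
  assumes "a \<noteq> b"
  shows "exp ((a + b) / 2) < (exp a + exp b) / 2"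
proof -
  have "0 < (exp (a / 2) - exp (b / 2))\<^sup>2" using assms by simp
  also have "\<dots> = exp a + exp b - 2 * exp ((a + b) / 2)"
    by (simp add: power2_diff add_divide_distrib exp_add flip: exp_double)
  finally show ?thesis by simp
qed

text \<open>Every term is midpoint convex; one exponent with positive coefficient that separates x
  from y makes the sum strict.\<close>

lemma exp_sum_midpoint_less:
  assumes "finite S" "\<And>s. s \<in> S \<Longrightarrow> 0 \<le> c s"
    and "r \<in> S" "0 < c r" "\<alpha> r \<bullet> (x - y) \<noteq> 0"
  shows "exp_sum S c \<alpha> ((1 / 2) *\<^sub>R (x + y)) < (exp_sum S c \<alpha> x + exp_sum S c \<alpha> y) / 2"
proof -
  have mid: "\<alpha> s \<bullet> ((1 / 2) *\<^sub>R (x + y)) = (\<alpha> s \<bullet> x + \<alpha> s \<bullet> y) / 2" for s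
    by (simp add: inner_add_right)
  have le: "exp ((a + b) / 2) \<le> (exp a + exp b) / 2" for a b :: real
    by (cases "a = b") (auto dest: exp_midpoint_less)
  have "exp_sum S c \<alpha> ((1 / 2) *\<^sub>R (x + y))
      < (\<Sum>s\<in>S. c s * ((exp (\<alpha> s \<bullet> x) + exp (\<alpha> s \<bullet> y)) / 2))"
    unfolding exp_sum_def mid
  proof (rule sum_strict_mono_ex1)
    show "\<forall>s\<in>S. c s * exp ((\<alpha> s \<bullet> x + \<alpha> s \<bullet> y) / 2) \<le> c s * ((exp (\<alpha> s \<bullet> x) + exp (\<alpha> s \<bullet> y)) / 2)"
      using assms(2) by (intro ballI mult_left_mono le)
    have "\<alpha> r \<bullet> x \<noteq> \<alpha> r \<bullet> y" using assms(5) by (simp add: inner_diff_right)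
    then show "\<exists>s\<in>S. c s * exp ((\<alpha> s \<bullet> x + \<alpha> s \<bullet> y) / 2) < c s * ((exp (\<alpha> s \<bullet> x) + exp (\<alpha> s \<bullet> y)) / 2)"
      using assms(3,4) by (intro bexI[of _ r] mult_strict_left_mono exp_midpoint_less)
  qed fact
  also have "\<dots> = (exp_sum S c \<alpha> x + exp_sum S c \<alpha> y) / 2"
    unfolding exp_sum_def by (simp add: sum_divide_distrib algebra_simps flip: sum.distrib)
  finally show ?thesis .
qed

text \<open>No term can exceed the whole sum, so taking logarithms bounds each exponent separately.
  The constant depends on M, but not on the point x.\<close>

lemma exp_sum_sublevel:
  assumes "finite S" "\<And>s. s \<in> S \<Longrightarrow> 0 \<le> c s"
  shows "\<exists>C\<ge>0. \<forall>x. exp_sum S c \<alpha> x \<le> M \<longrightarrow> (\<forall>s\<in>S. 0 < c s \<longrightarrow> \<alpha> s \<bullet> x \<le> C)"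
proof (intro exI conjI allI impI ballI)
  \<comment> \<open>Summing absolute values gives one nonnegative constant above every individual
    bound \<open>ln (M / c s)\<close>.\<close>
  define C where "C = (\<Sum>s\<in>S. \<bar>ln (M / c s)\<bar>)"
  show "0 \<le> C" by (simp add: C_def sum_nonneg)
  fix x s assume le: "exp_sum S c \<alpha> x \<le> M" and s: "s \<in> S" "0 < c s"
  have "c s * exp (\<alpha> s \<bullet> x) \<le> exp_sum S c \<alpha> x"
    unfolding exp_sum_def using assms s
    by (intro member_le_sum[where f = "\<lambda>s. c s * exp (\<alpha> s \<bullet> x)"]) auto
  with le s have *: "exp (\<alpha> s \<bullet> x) \<le> M / c s" by (simp add: field_simps)
  then have "\<alpha> s \<bullet> x \<le> ln (M / c s)"
    by (subst ln_ge_iff) (auto intro: less_le_trans[OF exp_gt_zero])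
  also have "\<dots> \<le> \<bar>ln (M / c s)\<bar>" by simp
  also have "\<dots> \<le> C"
    unfolding C_def using assms s by (intro member_le_sum[where f = "\<lambda>s. \<bar>ln (M / c s)\<bar>"]) auto
  finally show "\<alpha> s \<bullet> x \<le> C" .
qed

section \<open>Norm bounds from irreducibility\<close>

lemma path_increment_le:
  fixes y :: "'a \<Rightarrow> real"
  assumes "ps \<noteq> []" "0 \<le> C"
    and "\<And>l. Suc l < length ps \<Longrightarrow> y (ps ! Suc l) \<le> y (ps ! l) + C"
  shows "y (last ps) \<le> y (hd ps) + real (length ps) * C"
  using assms
proof (induction ps rule: list_nonempty_induct)
  case (single x)
  then show ?case by simp
next
  case (cons x xs)
  have "y (last xs) \<le> y (hd xs) + real (length xs) * C"
    using cons.prems cons.prems(2)[of "Suc _"] by (intro cons.IH) auto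
  moreover have "y (hd xs) \<le> y x + C"
    using cons.prems(2)[of 0] cons.hyps by (simp add: hd_conv_nth)
  ultimately show ?case using cons.hyps by (simp add: algebra_simps)
qed

text \<open>The increments telescope along a path from r to s. Distinctness of its indices bounds
  its length by the dimension and makes consecutive indices differ.\<close>

lemma irreducible_matrix_increment_le:
  fixes M :: "real^'k^'k" and y :: "'k \<Rightarrow> real"
  assumes "irreducible_matrix M" "0 \<le> C"
    and "\<And>a b. a \<noteq> b \<Longrightarrow> 0 < M $ a $ b \<Longrightarrow> y b \<le> y a + C"
  shows "y s \<le> y r + real CARD('k) * C"
proof (cases "r = s")
  case False
  with assms(1) obtain ps where ps: "ps \<noteq> []" "distinct ps" "hd ps = r" "last ps = s"
    "\<And>l. Suc l < length ps \<Longrightarrow> 0 < M $ (ps ! l) $ (ps ! Suc l)"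
    unfolding irreducible_matrix_def by blast
  have "y (ps ! Suc l) \<le> y (ps ! l) + C" if "Suc l < length ps" for l
    using that ps(2,5) by (intro assms(3)) (auto simp: nth_eq_iff_index_eq)
  then have "y s \<le> y r + real (length ps) * C"
    using path_increment_le[of ps C y] ps assms(2) by simp
  moreover have "length ps \<le> CARD('k)"
    using card_mono[of UNIV "set ps"] ps(2) by (simp add: distinct_card)
  then have "real (length ps) * C \<le> real CARD('k) * C"
    using assms(2) by (intro mult_right_mono) auto
  ultimately show ?thesis by linarith
qed (simp add: assms)

lemma infnorm_vec_le:
  fixes x :: "real^'n"
  assumes "\<And>k. \<bar>x $ k\<bar> \<le> b"
  shows "infnorm x \<le> b"
  unfolding infnorm_Max by (auto simp: Basis_vec_def inner_axis assms)

text \<open>Any two coordinates differ by at most n * C, hence each is that close to the mean of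
  all. The larger factor \<open>(n + 1)^2\<close> gives the same constant as in the bordered
  case.\<close>

lemma infnorm_le_if_irreducible:
  fixes L :: "real^'n^'n" and x :: "real^'n"
  assumes C: "0 \<le> C" and A: "\<And>k j. k \<noteq> j \<Longrightarrow> 0 < L $ k $ j \<Longrightarrow> x $ j - x $ k \<le> C"
    and irr: "irreducible_matrix L"
  shows "infnorm x \<le> (real CARD('n) + 1)\<^sup>2 * C + \<bar>\<Sum>k\<in>UNIV. x $ k\<bar>"
proof (rule infnorm_vec_le)
  fix k
  let ?n = "real CARD('n)" and ?s = "\<Sum>k\<in>UNIV. x $ k"
  have *: "x $ j \<le> x $ i + ?n * C" for i j
    using A by (intro irreducible_matrix_increment_le[OF irr C]) (simp add: algebra_simps)
  have "?n * x $ k = (\<Sum>j\<in>(UNIV::'n set). x $ k)" by simp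
  also have "\<dots> \<le> (\<Sum>j\<in>UNIV. x $ j + ?n * C)" by (intro sum_mono *)
  finally have 1: "?n * x $ k \<le> ?s + ?n * (?n * C)" by (simp add: sum.distrib)
  have "?s \<le> (\<Sum>j\<in>(UNIV::'n set). x $ k + ?n * C)" by (intro sum_mono *)
  then have 2: "?s \<le> ?n * x $ k + ?n * (?n * C)" by (simp add: algebra_simps)
  have "?n * \<bar>x $ k\<bar> \<le> \<bar>?s\<bar> + ?n * (?n * C)"
    using 1 2 by (cases "x $ k \<ge> 0") auto
  moreover have n: "1 \<le> ?n" using zero_less_card_finite[where 'a = 'n] by linarith
  then have "\<bar>?s\<bar> \<le> ?n * \<bar>?s\<bar>" using mult_right_mono[of 1 ?n "\<bar>?s\<bar>"] by simp
  ultimately have "?n * \<bar>x $ k\<bar> \<le> ?n * (?n * C + \<bar>?s\<bar>)" by (simp add: algebra_simps)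
  with n have "\<bar>x $ k\<bar> \<le> ?n * C + \<bar>?s\<bar>" by simp
  moreover have "?n * C \<le> (?n + 1)\<^sup>2 * C"
    using C by (intro mult_right_mono) (auto simp: power2_eq_square algebra_simps)
  ultimately show "\<bar>x $ k\<bar> \<le> (?n + 1)\<^sup>2 * C + \<bar>?s\<bar>" by linarith
qed

text \<open>Paths ending in \<open>None\<close> bound every coordinate from below by -(n + 1) * C.
  Together with the coordinate sum this also bounds each one from above.\<close>

lemma infnorm_le_if_bordered_irreducible:
  fixes L :: "real^'n^'n" and c x :: "real^'n"
  assumes C: "0 \<le> C" and A: "\<And>k j. k \<noteq> j \<Longrightarrow> 0 < L $ k $ j \<Longrightarrow> x $ j - x $ k \<le> C"
    and p: "\<And>k. 0 < c $ k \<Longrightarrow> - x $ k \<le> C"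
    and irr: "irreducible_matrix (bordered_matrix L c r d)"
  shows "infnorm x \<le> (real CARD('n) + 1)\<^sup>2 * C + \<bar>\<Sum>k\<in>UNIV. x $ k\<bar>"
proof (rule infnorm_vec_le)
  fix k
  let ?n = "real CARD('n)" and ?s = "\<Sum>k\<in>UNIV. x $ k"
  \<comment> \<open>Truncating at 0 makes the edges leaving the border index \<open>None\<close> harmless: they come from the
    all-ones row and say nothing about \<open>x\<close>.\<close>
  define y where "y = case_option 0 (\<lambda>k. min 0 (x $ k))"
  have "y b \<le> y a + C" if "a \<noteq> b" "0 < bordered_matrix L c r d $ a $ b" for a b
    using that C A p unfolding y_def bordered_matrix_def
    by (fastforce split: option.splits simp: min_def)
  then have "y None \<le> y (Some j) + real CARD('n option) * C" for j
    by (intro irreducible_matrix_increment_le[OF irr C])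
  then have lower: "0 \<le> x $ j + (?n + 1) * C" for j
    by (force simp: y_def min_def algebra_simps split: if_splits)
  \<comment> \<open>All shifted coordinates are nonnegative, so a single one is at most their
    total.\<close>
  have "x $ k + (?n + 1) * C \<le> (\<Sum>j\<in>UNIV. x $ j + (?n + 1) * C)"
    by (rule member_le_sum[where f = "\<lambda>j. x $ j + (?n + 1) * C"]) (auto intro: lower)
  then have "x $ k + (?n + 1) * C \<le> ?s + ?n * ((?n + 1) * C)"
    by (simp add: sum.distrib)
  moreover have "0 \<le> (?n + 1) * C" "0 \<le> ?n * ((?n + 1) * C)"
    using C by simp_all
  moreover have "(?n + 1)\<^sup>2 * C = ?n * ((?n + 1) * C) + (?n + 1) * C"
    by (simp add: power2_eq_square algebra_simps)
  ultimately show "\<bar>x $ k\<bar> \<le> (?n + 1)\<^sup>2 * C + \<bar>?s\<bar>"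
    using lower[of k] by linarith
qed

section \<open>Expansion of \<open>g_tilde\<close> into exponentials\<close>

text \<open>The terms of the k-th affine factor are indexed by an option: \<open>None\<close> stands
  for its constant, \<open>Some j\<close> for the term in the j-th variable.\<close>

definition affine_coeff :: "real^'n^'n \<Rightarrow> real^'n \<Rightarrow> 'n \<Rightarrow> 'n option \<Rightarrow> real" where
  "affine_coeff A p k = case_option (p $ k) (\<lambda>j. A $ k $ j)"

text \<open>Exponent of such a term after division by the k-th variable and the substitution \<xi> =
  exp x.\<close>

definition ratio_exponent :: "'n \<Rightarrow> 'n option \<Rightarrow> real^'n" where
  "ratio_exponent k a = case_option 0 (\<lambda>j. axis j 1) a - axis k 1"

lemma sum_option: "(\<Sum>a\<in>UNIV. f a) = f None + (\<Sum>j\<in>UNIV. f (Some j))"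
  for f :: "'n::finite option \<Rightarrow> 'b::comm_monoid_add"
  by (simp add: UNIV_option_conv sum.reindex)

text \<open>Distributing the product over the sums leaves one exponential for each choice function
  \<sigma>, which picks a term in every factor.\<close>

lemma E_fun_vec_exp:
  fixes A :: "real^'n^'n"
  shows "E_fun A p (vec_exp x) =
    exp_sum UNIV (\<lambda>\<sigma>. \<Prod>k\<in>UNIV. affine_coeff A p k (\<sigma> k))
      (\<lambda>\<sigma>. \<Sum>k\<in>UNIV. ratio_exponent k (\<sigma> k)) x"
proof -
  have "1 / exp (x $ k) * (p $ k + (\<Sum>j\<in>UNIV. A $ k $ j * exp (x $ j)))
      = (\<Sum>a\<in>UNIV. affine_coeff A p k a * exp (ratio_exponent k a \<bullet> x))" for k
    by (simp add: sum_option affine_coeff_def ratio_exponent_def inner_diff_left inner_axis'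
        exp_diff exp_minus sum_distrib_left field_simps)
  then have "E_fun A p (vec_exp x)
      = (\<Prod>k\<in>UNIV. \<Sum>a\<in>UNIV. affine_coeff A p k a * exp (ratio_exponent k a \<bullet> x))"
    by (simp add: E_fun_def vec_exp_def)
  also have "\<dots> = (\<Sum>\<sigma>\<in>UNIV. \<Prod>k\<in>UNIV. affine_coeff A p k (\<sigma> k) * exp (ratio_exponent k (\<sigma> k) \<bullet> x))"
    by (subst prod_sum_PiE) auto
  also have "\<dots> = exp_sum UNIV (\<lambda>\<sigma>. \<Prod>k\<in>UNIV. affine_coeff A p k (\<sigma> k))
      (\<lambda>\<sigma>. \<Sum>k\<in>UNIV. ratio_exponent k (\<sigma> k)) x"
    by (simp add: exp_sum_def prod.distrib inner_sum_left exp_sum)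
  finally show ?thesis .
qed

definition expansion_coeff ::
    "('i \<Rightarrow> real^'n^'n) \<Rightarrow> ('i \<Rightarrow> real^'n) \<Rightarrow> 'i \<times> ('n \<Rightarrow> 'n option) \<Rightarrow> real" where
  "expansion_coeff A p = (\<lambda>(i, \<sigma>). \<Prod>k\<in>UNIV. affine_coeff (A i) (p i) k (\<sigma> k))"

definition expansion_exponent :: "'i \<times> ('n \<Rightarrow> 'n option) \<Rightarrow> real^'n" where
  "expansion_exponent = (\<lambda>(i, \<sigma>). \<Sum>k\<in>UNIV. ratio_exponent k (\<sigma> k))"

lemma g_tilde_eq_exp_sum:
  "g_tilde I A p = exp_sum (I \<times> UNIV) (expansion_coeff A p) expansion_exponent"
  by (rule ext) (simp add: g_tilde_def E_tilde_def E_fun_vec_exp exp_sum_def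
      expansion_coeff_def expansion_exponent_def sum.cartesian_product split_def)

text \<open>The diagonal choice \<open>Some l\<close> in factor l has exponent 0, so only factor k
  contributes.\<close>

lemma expansion_exponent_single:
  "expansion_exponent (i, \<lambda>l. if l = k then a else Some l) = ratio_exponent k a"
proof -
  have "(\<Sum>l\<in>UNIV. ratio_exponent l (if l = k then a else Some l))
      = (\<Sum>l\<in>UNIV. if l = k then ratio_exponent k a else 0)"
    by (intro sum.cong) (auto simp: ratio_exponent_def)
  then show ?thesis by (simp add: expansion_exponent_def)
qed

lemma expansion_coeff_single_pos:
  assumes "0 < affine_coeff (A i) (p i) k a" "\<And>l. 0 < A i $ l $ l"
  shows "0 < expansion_coeff A p (i, \<lambda>l. if l = k then a else Some l)"
  unfolding expansion_coeff_def using assms by (auto intro!: prod_pos simp: affine_coeff_def)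

lemma expansion_coeff_nonneg:
  assumes "\<And>k j. 0 \<le> A (fst s) $ k $ j" "\<And>k. 0 \<le> p (fst s) $ k"
  shows "0 \<le> expansion_coeff A p s"
  unfolding expansion_coeff_def using assms
  by (auto intro!: prod_nonneg simp: affine_coeff_def split: option.split prod.split)

section \<open>Strict convexity, coercivity and minimisation on the hyperplane\<close>

text \<open>The last assumption with \<open>C = 0\<close> gives strict convexity on the hyperplane, and with
  arbitrary \<open>C\<close> it gives coercivity.\<close>

locale coercive_exp_sum =
  fixes S :: "'s set" and c :: "'s \<Rightarrow> real" and \<alpha> :: "'s \<Rightarrow> real^'n" and K :: real
  assumes finite_S: "finite S"
    and c_nonneg: "\<And>s. s \<in> S \<Longrightarrow> 0 \<le> c s"
    and bound: "\<And>x C. 0 \<le> C \<Longrightarrow> (\<And>s. s \<in> S \<Longrightarrow> 0 < c s \<Longrightarrow> \<alpha> s \<bullet> x \<le> C) \<Longrightarrow>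
      infnorm x \<le> K * C + \<bar>\<Sum>k\<in>UNIV. x $ k\<bar>"
begin

lemma exponent_neq_0:
  assumes "h \<in> sum_hyperplane 0 - {0}"
  obtains s where "s \<in> S" "0 < c s" "\<alpha> s \<bullet> h \<noteq> 0"
proof (rule ccontr)
  assume "\<not> thesis"
  then have "infnorm h \<le> K * 0 + \<bar>\<Sum>k\<in>UNIV. h $ k\<bar>"
    using that by (intro bound) force+
  then have "infnorm h \<le> 0" using assms by (simp add: sum_hyperplane_def)
  then have "h = 0" using infnorm_pos_le[of h] infnorm_eq_0[of h] by simp
  with assms show False by simp
qed

lemma second_derivative_pos:
  "\<exists>D. has_second_derivative_at (exp_sum S c \<alpha>) D x \<and>
    (\<forall>h\<in>sum_hyperplane 0 - {0}. 0 < blinfun_apply (blinfun_apply D h) h)"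
proof -
  obtain D where D: "has_second_derivative_at (exp_sum S c \<alpha>) D x"
    "\<And>h. blinfun_apply (blinfun_apply D h) h = (\<Sum>s\<in>S. c s * exp (\<alpha> s \<bullet> x) * (\<alpha> s \<bullet> h)\<^sup>2)"
    using exp_sum_second_derivative by blast
  have "0 < blinfun_apply (blinfun_apply D h) h" if h: "h \<in> sum_hyperplane 0 - {0}" for h
  proof -
    obtain s where "s \<in> S" "0 < c s" "\<alpha> s \<bullet> h \<noteq> 0" using exponent_neq_0[OF h] .
    then show ?thesis
      unfolding D(2) by (intro sum_pos2[OF finite_S]) (auto intro!: mult_nonneg_nonneg c_nonneg)
  qed
  with D(1) show ?thesis by blast
qed

text \<open>On a sublevel set the active exponents are bounded, and on the hyperplane the coordinate
  sum is fixed, so \<open>bound\<close> applies with a constant C.\<close>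

lemma sublevel_bounded:
  obtains N where "\<And>x. x \<in> sum_hyperplane \<gamma> \<Longrightarrow> exp_sum S c \<alpha> x \<le> M \<Longrightarrow> infnorm x \<le> N"
proof -
  obtain C where C: "0 \<le> C"
    "\<And>x s. exp_sum S c \<alpha> x \<le> M \<Longrightarrow> s \<in> S \<Longrightarrow> 0 < c s \<Longrightarrow> \<alpha> s \<bullet> x \<le> C"
    using exp_sum_sublevel[of S c \<alpha> M] finite_S c_nonneg by blast
  show ?thesis
  proof (rule that)
    fix x :: "real^'n" assume x: "x \<in> sum_hyperplane \<gamma>" and le: "exp_sum S c \<alpha> x \<le> M"
    have "infnorm x \<le> K * C + \<bar>\<Sum>k\<in>UNIV. x $ k\<bar>"
      by (intro bound C le)
    with x show "infnorm x \<le> K * C + \<bar>\<gamma>\<bar>" by (simp add: sum_hyperplane_def)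
  qed
qed

lemma filterlim_infnorm_at_top:
  "filterlim (exp_sum S c \<alpha>) at_top
    (inf (filtercomap infnorm at_top) (principal (sum_hyperplane \<gamma>)))"
  unfolding filterlim_at_top
proof
  fix M
  obtain N where N: "\<And>x. x \<in> sum_hyperplane \<gamma> \<Longrightarrow> exp_sum S c \<alpha> x \<le> M \<Longrightarrow> infnorm x \<le> N"
    using sublevel_bounded by metis
  \<comment> \<open>The margin 1 makes the contrapositive of N applicable, which needs
    \<open>infnorm x\<close> strictly above \<open>N\<close>.\<close>
  have "\<forall>x. N + 1 \<le> infnorm x \<longrightarrow> x \<in> sum_hyperplane \<gamma> \<longrightarrow> M \<le> exp_sum S c \<alpha> x"
    using N by force
  then show "eventually (\<lambda>x. M \<le> exp_sum S c \<alpha> x)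
      (inf (filtercomap infnorm at_top) (principal (sum_hyperplane \<gamma>)))"
    unfolding eventually_inf_principal eventually_filtercomap_at_top_linorder by blast
qed

text \<open>Existence comes from compactness of a truncated hyperplane, uniqueness from strict
  midpoint convexity along differences in the zero-sum hyperplane.\<close>

lemma minimum_on_hyperplane:
  "\<exists>!x. is_arg_min (exp_sum S c \<alpha>) (\<lambda>x. x \<in> sum_hyperplane \<gamma>) x"
proof -
  let ?V = "sum_hyperplane \<gamma> :: (real^'n) set" and ?g = "exp_sum S c \<alpha>"
  define x\<^sub>0 :: "real^'n" where "x\<^sub>0 = (\<chi> k. \<gamma> / real CARD('n))"
  have x0: "x\<^sub>0 \<in> ?V" by (simp add: x\<^sub>0_def sum_hyperplane_def)
  obtain N where N: "\<And>x. x \<in> ?V \<Longrightarrow> ?g x \<le> ?g x\<^sub>0 \<Longrightarrow> infnorm x \<le> N"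
    using sublevel_bounded by metis
  \<comment> \<open>The square root of the dimension converts the bound on \<open>infnorm\<close>
    into a Euclidean ball, which thus contains the sublevel set of \<open>x\<^sub>0\<close>.\<close>
  define T where "T = ?V \<inter> cball 0 (sqrt DIM(real^'n) * N)"
  have T: "x \<in> T" if "x \<in> ?V" "?g x \<le> ?g x\<^sub>0" for x
    using N[OF that] norm_le_infnorm[of x] that
    by (auto simp: T_def intro: order.trans mult_left_mono)
  have "closed ?V"
    unfolding sum_hyperplane_def by (intro closed_Collect_eq continuous_intros)
  then have "compact T" by (simp add: T_def closed_Int_compact)
  moreover have "continuous_on T ?g"
    unfolding exp_sum_def by (intro continuous_intros)
  ultimately obtain x where x: "x \<in> T" "\<And>y. y \<in> T \<Longrightarrow> ?g x \<le> ?g y"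
    using continuous_attains_inf[of T ?g] T[OF x0] by blast
  \<comment> \<open>A point of the hyperplane outside \<open>T\<close> has a value above that of
    \<open>x\<^sub>0\<close>, which lies in \<open>T\<close>.\<close>
  have min: "?g x \<le> ?g y" if "y \<in> ?V" for y
    using x(2)[of y] x(2)[of x\<^sub>0] T[OF that] T[OF x0] by linarith
  show ?thesis
  proof (rule ex1I)
    show "is_arg_min ?g (\<lambda>x. x \<in> ?V) x"
      using x(1) min by (auto simp: is_arg_min_def T_def not_less)
    fix y assume y: "is_arg_min ?g (\<lambda>x. x \<in> ?V) y"
    show "y = x"
    proof (rule ccontr)
      assume "y \<noteq> x"
      with x(1) y have "y - x \<in> sum_hyperplane 0 - {0}"
        by (simp add: T_def is_arg_min_def sum_hyperplane_def sum_subtractf)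
      then obtain s where "s \<in> S" "0 < c s" "\<alpha> s \<bullet> (y - x) \<noteq> 0" by (rule exponent_neq_0)
      then have "?g ((1 / 2) *\<^sub>R (y + x)) < (?g y + ?g x) / 2"
        using finite_S c_nonneg by (intro exp_sum_midpoint_less)
      moreover have mid: "(1 / 2) *\<^sub>R (y + x) \<in> ?V"
        using x(1) y by (simp add: T_def is_arg_min_def sum_hyperplane_def sum.distrib flip: sum_distrib_left sum_divide_distrib)
      moreover have "?g y \<le> ?g x"
        using x(1) y by (force simp: T_def is_arg_min_def)
      ultimately show False using min[OF mid] by simp
    qed
  qed
qed

end

section \<open>Return to the original variables and conclusion\<close>

text \<open>The map \<open>vec_exp\<close> takes the hyperplane onto the constraint set, with the
  componentwise logarithm as preimage, so minimisers correspond.\<close>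

lemma ex1_arg_min_vec_exp:
  fixes f :: "real^'n \<Rightarrow> real"
  assumes "\<exists>!x. is_arg_min (\<lambda>x. f (vec_exp x)) (\<lambda>x. x \<in> sum_hyperplane \<gamma>) x"
  shows "\<exists>!\<xi>. is_arg_min f (\<lambda>\<xi>. (\<forall>k. 0 < \<xi> $ k) \<and> exp \<gamma> = (\<Prod>k\<in>UNIV. \<xi> $ k)) \<xi>"
proof -
  define P where "P = (\<lambda>\<xi>::real^'n. (\<forall>k. 0 < \<xi> $ k) \<and> exp \<gamma> = (\<Prod>k\<in>UNIV. \<xi> $ k))"
  have P_exp: "P (vec_exp x) \<longleftrightarrow> x \<in> sum_hyperplane \<gamma>" for x
    by (auto simp: P_def vec_exp_def sum_hyperplane_def simp flip: exp_sum)
  have P_obtain: "\<exists>x. \<xi> = vec_exp x" if "P \<xi>" for \<xi>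
    using that by (intro exI[of _ "\<chi> k. ln (\<xi> $ k)"]) (auto simp: P_def vec_exp_def vec_eq_iff)
  have *: "is_arg_min f P (vec_exp x) \<longleftrightarrow>
      is_arg_min (\<lambda>x. f (vec_exp x)) (\<lambda>x. x \<in> sum_hyperplane \<gamma>) x" for x
    unfolding is_arg_min_def by (metis P_exp P_obtain)
  have "\<exists>!\<xi>. is_arg_min f P \<xi>"
    using assms * P_obtain unfolding is_arg_min_def by (metis (no_types, lifting))
  then show ?thesis by (simp add: P_def)
qed

theorem theoremV4:
  fixes \<gamma> \<tau> :: real
    and z :: "real^'n"
    and I :: "'i set"
    and L A :: "'i \<Rightarrow> real^'n^'n"
    and v p :: "'i \<Rightarrow> real^'n"
  assumes "\<tau> > 0"
    and "\<And>k. 0 \<le> z $ k"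
    and "finite I"
    and "\<And>i. i \<in> I \<Longrightarrow> essentially_nonneg (L i)"
    and "\<And>i k. i \<in> I \<Longrightarrow> 0 \<le> v i $ k"
    and "\<And>i. i \<in> I \<Longrightarrow> A i = mat 1 + matrix_exp (\<tau> *\<^sub>R L i)"
    and "\<And>i. i \<in> I \<Longrightarrow> p i = 2 *\<^sub>R (A i *v z + v i)"
    and "\<exists>i\<in>I. irreducible_matrix (L i) \<or>
           irreducible_matrix (bordered_matrix (L i) (z + L i *v z + v i) (vec 1) 1)"
  shows "(\<exists>!\<xi>. is_arg_min (E_tilde I A p)
            (\<lambda>\<xi>. (\<forall>k. 0 < \<xi> $ k) \<and> exp \<gamma> = (\<Prod>k\<in>UNIV. \<xi> $ k)) \<xi>)
    \<and> (\<forall>x\<in>sum_hyperplane \<gamma>. \<exists>D. has_second_derivative_at (g_tilde I A p) D x \<and>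
         (\<forall>h\<in>sum_hyperplane 0 - {0}. 0 < blinfun_apply (blinfun_apply D h) h))
    \<and> filterlim (g_tilde I A p) at_top
         (inf (filtercomap infnorm at_top) (principal (sum_hyperplane \<gamma>)))"
proof -
  have A_ge: "mat 1 $ k $ j \<le> A i $ k $ j" if "i \<in> I" for i k j
  proof -
    have "essentially_nonneg (\<tau> *\<^sub>R L i)"
      using assms(1,4) that by (simp add: essentially_nonneg_def)
    with assms(6) that show ?thesis by (simp add: matrix_exp_nonneg)
  qed
  have A_pos: "0 < A i $ k $ j" if "i \<in> I" "k \<noteq> j" "0 < L i $ k $ j" for i k j
  proof -
    have "essentially_nonneg (\<tau> *\<^sub>R L i)"
      using assms(1,4) that by (simp add: essentially_nonneg_def)
    with assms(1,6) that show ?thesis by (simp add: matrix_exp_pos mat_def)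
  qed
  have A_nonneg: "0 \<le> A i $ k $ j" if "i \<in> I" for i k j
    using A_ge[OF that, of k j] by (simp add: mat_def split: if_splits)
  have A_diag: "0 < A i $ k $ k" if "i \<in> I" for i k
    using A_ge[OF that, of k k] by (simp add: mat_def)
  have p: "p i $ k = 2 * ((\<Sum>j\<in>UNIV. A i $ k $ j * z $ j) + v i $ k)" if "i \<in> I" for i k
    using assms(7)[OF that] by (simp add: matrix_vector_mult_def)
  have p_nonneg: "0 \<le> p i $ k" if "i \<in> I" for i k
    using that assms(2,5) A_nonneg by (simp add: p sum_nonneg)
  \<comment> \<open>If the entry of \<open>p i\<close> vanished, so would \<open>v i\<close> and
    \<open>z\<close> at k and all products of \<open>A i\<close> with \<open>z\<close> in row k. A
    positive \<open>z $ j\<close> would then force \<open>L i $ k $ j\<close> to be nonpositive, so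
    the border entry could not be positive.\<close>
  have p_pos: "0 < p i $ k" if i: "i \<in> I" and pos: "0 < (z + L i *v z + v i) $ k" for i k
  proof (rule ccontr)
    assume "\<not> 0 < p i $ k"
    moreover have "0 \<le> (\<Sum>j\<in>UNIV. A i $ k $ j * z $ j)"
      using i assms(2) A_nonneg by (simp add: sum_nonneg)
    ultimately have v: "v i $ k = 0" and "(\<Sum>j\<in>UNIV. A i $ k $ j * z $ j) = 0"
      using i assms(5)[OF i, of k] by (auto simp: p)
    then have Az: "A i $ k $ j * z $ j = 0" for j
      using i assms(2) A_nonneg by (subst (asm) sum_nonneg_eq_0_iff) auto
    then have zk: "z $ k = 0" using A_diag[OF i, of k] by (metis less_irrefl mult_eq_0_iff)
    have "L i $ k $ j * z $ j \<le> 0" for j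
    proof (cases "k = j \<or> z $ j = 0")
      case False
      with Az[of j] A_pos[OF i, of k j] have "L i $ k $ j \<le> 0" by force
      with assms(2)[of j] show ?thesis by (simp add: mult_nonpos_nonneg)
    qed (use zk in auto)
    then have "(L i *v z) $ k \<le> 0" by (simp add: matrix_vector_mult_def sum_nonpos)
    with pos v zk show False by simp
  qed
  obtain i where i: "i \<in> I" and irr: "irreducible_matrix (L i) \<or>
      irreducible_matrix (bordered_matrix (L i) (z + L i *v z + v i) (vec 1) 1)"
    using assms(8) by blast
  \<comment> \<open>The norm bound uses only the exponents of the one irreducible index i; the other
    indices just need nonnegative coefficients.\<close>
  interpret coercive_exp_sum "I \<times> UNIV" "expansion_coeff A p" expansion_exponent "(real CARD('n) + 1)\<^sup>2"
  proof
    show "finite (I \<times> (UNIV :: ('n \<Rightarrow> 'n option) set))" using assms(3) by simp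
    show "0 \<le> expansion_coeff A p s" if "s \<in> I \<times> UNIV" for s
      using that by (intro expansion_coeff_nonneg) (auto intro: A_nonneg p_nonneg)
    fix x C
    assume C: "0 \<le> C" and le: "\<And>s. s \<in> I \<times> UNIV \<Longrightarrow> 0 < expansion_coeff A p s \<Longrightarrow> expansion_exponent s \<bullet> x \<le> C"
    \<comment> \<open>The choice function takes the diagonal term in every factor except k, where it
      takes a.\<close>
    have ratio: "ratio_exponent k a \<bullet> x \<le> C" if "0 < affine_coeff (A i) (p i) k a" for k a
      using le[of "(i, \<lambda>l. if l = k then a else Some l)"] i that A_diag
      by (simp add: expansion_exponent_single expansion_coeff_single_pos)
    have A: "x $ j - x $ k \<le> C" if "k \<noteq> j" "0 < L i $ k $ j" for k j
      using ratio[of k "Some j"] A_pos[OF i that]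
      by (simp add: affine_coeff_def ratio_exponent_def inner_diff_left inner_axis')
    have p: "- x $ k \<le> C" if "0 < (z + L i *v z + v i) $ k" for k
      using ratio[of k None] p_pos[OF i that]
      by (simp add: affine_coeff_def ratio_exponent_def inner_axis')
    show "infnorm x \<le> (real CARD('n) + 1)\<^sup>2 * C + \<bar>\<Sum>k\<in>UNIV. x $ k\<bar>"
      using irr infnorm_le_if_irreducible[OF C A] infnorm_le_if_bordered_irreducible[OF C A p]
      by blast
  qed
  have "\<exists>!\<xi>. is_arg_min (E_tilde I A p)
      (\<lambda>\<xi>. (\<forall>k. 0 < \<xi> $ k) \<and> exp \<gamma> = (\<Prod>k\<in>UNIV. \<xi> $ k)) \<xi>"
    using minimum_on_hyperplane[of \<gamma>] unfolding g_tilde_eq_exp_sum[symmetric] g_tilde_def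
    by (rule ex1_arg_min_vec_exp)
  then show ?thesis
    using second_derivative_pos filterlim_infnorm_at_top by (simp add: g_tilde_eq_exp_sum)
qed

end
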